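(* Let $\mathcal X$ be a normed vector space, $\mathcal Y$ an inner product space, $T,T_n:\mathcal X\to\mathcal Y$ ($n=1,2,\dots$) bounded linear operators, $y,y_n\in\mathcal Y$, $\alpha>0$, $\alpha_n\in\mathbb R$, $\mathcal D$ a subset of $\mathcal X$, and $W:\mathcal D\to\mathbb R$ a functional satisfying: (1) there exists $\gamma\ge 0$ such that $W(x)\ge-\gamma$ for all $x\in\mathcal D$; (2) for every $W$-bounded sequence $\{x_n\}\subset\mathcal D$ converging in norm to some $x\in\mathcal D$, there exists a subsequence $\{x_{n_j}\}$ such that $W(x)\le\liminf_{j\to\infty}W(x_{n_j})$; (3) for every $W$-bounded sequence $\{x_n\}\subset\mathcal D$ there exist a subsequence $\{x_{n_j}\}$ and $x\in\mathcal D$ such that $x_{n_j}\to x$ in norm. Define on $\mathcal D$ the functionals $$J(x)=\|Tx-y\|^2+\alpha W(x),\qquad J_n(x)=\|T_nx-y_n\|^2+\alpha_nW(x),\quad n=1,2,\dots,$$ and assume that as $n\to\infty$, $\alpha_n\to\alpha$, $y_n\to y$ and $T_nx\to Tx$ uniformly on $W$-bounded sets. Suppose further that $J$ has a unique global minimizer $\bar x$ on $\mathcal D$. If, for each $n$, $x_n$ is a global minimizer of $J_n$ on $\mathcal D$, then $x_n\to\bar x$ in norm.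
   Context: A sequence or subset of $\mathcal D$ is $W$-bounded if there is a constant $k<\infty$ with $|W(x)|\le k$ for all its elements $x$. "$T_nx\to Tx$ uniformly on $W$-bounded sets" means: for any $c>0$ and $\epsilon>0$ there exists $N$ such that $\|T_nx-Tx\|<\epsilon$ for every $n\ge N$ and every $x\in\mathcal D$ with $|W(x)|\le c$. *)

theory Defs
  imports "HOL-Analysis.Analysis"
begin

text \<open>
  A functional W : D \<rightarrow> \<real> is a total function together with its domain D;
  only its values on D are ever constrained or used.
\<close>

definition W_bounded :: "'a set \<Rightarrow> ('a \<Rightarrow> real) \<Rightarrow> 'a set \<Rightarrow> bool" where
  "W_bounded D W S \<longleftrightarrow> S \<subseteq> D \<and> (\<exists>k. \<forall>x\<in>S. \<bar>W x\<bar> \<le> k)"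

definition W_bounded_seq :: "'a set \<Rightarrow> ('a \<Rightarrow> real) \<Rightarrow> (nat \<Rightarrow> 'a) \<Rightarrow> bool" where
  "W_bounded_seq D W s \<longleftrightarrow> W_bounded D W (range s)"

definition uniform_on_W_bounded ::
  "'a set \<Rightarrow> ('a \<Rightarrow> real) \<Rightarrow> (nat \<Rightarrow> 'a \<Rightarrow> 'b::metric_space) \<Rightarrow> ('a \<Rightarrow> 'b) \<Rightarrow> bool" where
  "uniform_on_W_bounded D W Tn T \<longleftrightarrow>
     (\<forall>c>0. uniform_limit {x \<in> D. \<bar>W x\<bar> \<le> c} Tn T sequentially)"

definition tikhonov ::
  "('a \<Rightarrow> 'b::real_normed_vector) \<Rightarrow> 'b \<Rightarrow> real \<Rightarrow> ('a \<Rightarrow> real) \<Rightarrow> 'a \<Rightarrow> real" where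
  "tikhonov T y \<alpha> W x = (norm (T x - y))\<^sup>2 + \<alpha> * W x"

abbreviation global_minimizer_on :: "'a set \<Rightarrow> ('a \<Rightarrow> real) \<Rightarrow> 'a \<Rightarrow> bool" where
  "global_minimizer_on D J x \<equiv> is_arg_min J (\<lambda>z. z \<in> D) x"

end

theory Submission
  imports Defs
begin

text \<open>
  The statement is the stability of Tikhonov regularisation under perturbation of the operator, the
  data and the regularisation parameter. It is an instance of the direct method. Comparing
  \<open>x\<^sub>n\<close> with one fixed competitor bounds \<open>\<alpha>\<^sub>n W(x\<^sub>n)\<close> from above, because the residual term is
  nonnegative; as \<open>\<alpha>\<^sub>n\<close> stays away from \<open>0\<close>, the minimizers are eventually \<open>W\<close>-bounded
  (\<open>tikhonov_minimizers_eventually_W_bounded\<close>). Compactness therefore gives every subsequence a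
  further subsequence converging to some \<open>x \<in> D\<close>.

  Along it the residuals converge: uniformity of \<open>T\<^sub>n \<rightarrow> T\<close> on \<open>W\<close>-bounded sets permits the
  argument to move with \<open>n\<close> (\<open>tendsto_uniform_limit_moving_argument\<close>), and \<open>T\<close> is continuous.
  Together with the lower semicontinuity of \<open>W\<close> this yields \<open>J(x) \<le> liminf J\<^sub>n(x\<^sub>n) \<le> lim J\<^sub>n(z) = J(z)\<close>
  along the subsequence, for every \<open>z \<in> D\<close> (\<open>tikhonov_le_of_perturbed_le\<close>), so \<open>x\<close> minimizes \<open>J\<close>, and uniqueness
  identifies it with \<open>xbar\<close>. Since every subsequence has a further subsequence with the same limit
  \<open>xbar\<close>, the whole sequence converges (\<open>LIMSEQ_if_subseq_has_subseq_LIMSEQ\<close>).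
\<close>

text \<open>
  Failure of convergence leaves infinitely many terms at a fixed distance from \<open>l\<close>, and no subsequence
  of these can tend to \<open>l\<close>. The predicate \<open>P\<close> lets the subsequences avoid a finite exceptional
  set, which is how a property that holds only eventually becomes available for all their terms.
\<close>
lemma LIMSEQ_if_subseq_has_subseq_LIMSEQ:
  fixes f :: "nat \<Rightarrow> 'a::metric_space"
  assumes ev: "\<forall>\<^sub>F n in sequentially. P n"
    and sub: "\<And>r :: nat \<Rightarrow> nat. \<lbrakk>strict_mono r; \<And>j. P (r j)\<rbrakk> \<Longrightarrow>
           \<exists>q :: nat \<Rightarrow> nat. strict_mono q \<and> (\<lambda>j. f (r (q j))) \<longlonglongrightarrow> l"
  shows "f \<longlonglongrightarrow> l"
proof (rule ccontr)
  assume "\<not> f \<longlonglongrightarrow> l"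
  then obtain e where e: "e > 0" and freq: "\<exists>\<^sub>F n in sequentially. \<not> dist (f n) l < e"
    by (auto simp: tendsto_iff frequently_def)
  have "\<exists>\<^sub>F n in sequentially. P n \<and> \<not> dist (f n) l < e"
    using freq ev by (rule frequently_rev_mp[OF _ eventually_mono]) auto
  then have "infinite {n. P n \<and> \<not> dist (f n) l < e}"
    by (simp add: frequently_cofinite flip: cofinite_eq_sequentially)
  then obtain r :: "nat \<Rightarrow> nat" where r: "strict_mono r" "\<And>j. P (r j)"
    and far: "\<And>j. \<not> dist (f (r j)) l < e"
    using infinite_enumerate by blast
  obtain q :: "nat \<Rightarrow> nat" where "(\<lambda>j. f (r (q j))) \<longlonglongrightarrow> l"
    using sub[OF r] by blast
  from tendstoD[OF this e] far show False
    by simp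
qed

lemma tendsto_uniform_limit_moving_argument:
  fixes f :: "'i \<Rightarrow> 'a \<Rightarrow> 'b::metric_space"
  assumes unif: "uniform_limit S f g F"
    and mem: "\<forall>\<^sub>F i in F. u i \<in> S"
    and lim: "((\<lambda>i. g (u i)) \<longlongrightarrow> L) F"
  shows "((\<lambda>i. f i (u i)) \<longlongrightarrow> L) F"
proof (rule tendstoI)
  fix e :: real
  assume "e > 0"
  then have "e / 2 > 0" by simp
  with uniform_limitD[OF unif] tendstoD[OF lim]
  have "\<forall>\<^sub>F i in F. \<forall>x\<in>S. dist (f i x) (g x) < e / 2" "\<forall>\<^sub>F i in F. dist (g (u i)) L < e / 2"
    by blast+
  with mem show "\<forall>\<^sub>F i in F. dist (f i (u i)) L < e"
  proof eventually_elim
    case (elim i)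
    then have "dist (f i (u i)) (g (u i)) < e / 2" by blast
    with elim(3) show ?case
      using dist_triangle[of "f i (u i)" L "g (u i)"] by linarith
  qed
qed

lemma tikhonov_tendsto:
  assumes "(\<alpha>n \<longlongrightarrow> \<alpha>) F" "(yn \<longlongrightarrow> y) F" "((\<lambda>i. Tn i z) \<longlongrightarrow> T z) F"
  shows "((\<lambda>i. tikhonov (Tn i) (yn i) (\<alpha>n i) W z) \<longlongrightarrow> tikhonov T y \<alpha> W z) F"
  unfolding tikhonov_def by (intro tendsto_intros assms)

text \<open>
  Beating a competitor whose values stay below \<open>M\<close> forces \<open>\<alpha>\<^sub>i W(u\<^sub>i) \<le> M\<close>, as the squared residual is
  nonnegative, and hence \<open>W(u\<^sub>i) \<le> 2M/\<alpha>\<close> as soon as \<open>\<alpha>\<^sub>i > \<alpha>/2\<close>.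
\<close>
lemma tikhonov_minimizers_eventually_W_bounded:
  assumes \<alpha>: "\<alpha> > 0" "(\<alpha>n \<longlongrightarrow> \<alpha>) F"
    and below: "\<And>x. x \<in> D \<Longrightarrow> W x \<ge> - \<gamma>"
    and mem: "\<forall>\<^sub>F i in F. u i \<in> D"
    and le: "\<forall>\<^sub>F i in F. tikhonov (Tn i) (yn i) (\<alpha>n i) W (u i) \<le> b i"
    and lim: "(b \<longlongrightarrow> B) F"
  obtains c where "c > 0" "\<forall>\<^sub>F i in F. u i \<in> {x \<in> D. \<bar>W x\<bar> \<le> c}"
proof -
  define M where "M = \<bar>B\<bar> + 1"
  define c where "c = 2 * M / \<alpha> + \<bar>\<gamma>\<bar>"
  have M: "M > 0" "B < M" by (auto simp: M_def)
  have c: "c > 0" using M \<alpha>(1) by (simp add: c_def add_pos_nonneg)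
  have "\<forall>\<^sub>F i in F. \<alpha>n i > \<alpha> / 2"
    using \<alpha> by (intro order_tendstoD(1)) auto
  moreover have "\<forall>\<^sub>F i in F. b i < M"
    using lim M(2) by (rule order_tendstoD(2))
  ultimately have "\<forall>\<^sub>F i in F. u i \<in> {x \<in> D. \<bar>W x\<bar> \<le> c}"
    using mem le
  proof eventually_elim
    case (elim i)
    have upper: "\<alpha>n i * W (u i) \<le> M"
      using elim(2,4) zero_le_power2[of "norm (Tn i (u i) - yn i)"]
      unfolding tikhonov_def by linarith
    have "W (u i) \<le> 2 * M / \<alpha>"
    proof (cases "W (u i) \<le> 0")
      case True
      moreover have "0 \<le> 2 * M / \<alpha>" using M \<alpha>(1) by simp
      ultimately show ?thesis by linarith
    next
      case False
      then have "\<alpha> / 2 * W (u i) \<le> \<alpha>n i * W (u i)"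
        using elim(1) by (intro mult_right_mono) auto
      with upper show ?thesis
        using \<alpha>(1) by (simp add: field_simps)
    qed
    moreover have "0 \<le> 2 * M / \<alpha>" using M \<alpha>(1) by simp
    ultimately show ?case
      using below[OF elim(3)] elim(3) by (auto simp: c_def)
  qed
  with c that show thesis by blast
qed

text \<open>
  The residuals converge and only \<open>W\<close> is lower semicontinuous, so \<open>W(u\<^sub>i)\<close> is replaced by the constant
  \<open>W(x) - e\<close>, which it eventually exceeds. The estimate then involves convergent real families only;
  the limit along \<open>F\<close> comes first and \<open>e \<rightarrow> 0\<close> afterwards.
\<close>
lemma tikhonov_le_of_perturbed_le:
  assumes F: "F \<noteq> bot"
    and \<alpha>: "\<alpha> > 0" "(\<alpha>n \<longlongrightarrow> \<alpha>) F"
    and y: "(yn \<longlongrightarrow> y) F"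
    and T: "((\<lambda>i. Tn i (u i)) \<longlongrightarrow> T x) F"
    and lsc: "ereal (W x) \<le> Liminf F (\<lambda>i. ereal (W (u i)))"
    and le: "\<forall>\<^sub>F i in F. tikhonov (Tn i) (yn i) (\<alpha>n i) W (u i) \<le> b i"
    and lim: "(b \<longlongrightarrow> B) F"
  shows "tikhonov T y \<alpha> W x \<le> B"
proof -
  have approx: "(norm (T x - y))\<^sup>2 + \<alpha> * (W x - e) \<le> B" if "e > 0" for e
  proof (rule tendsto_le[OF F lim])
    show "((\<lambda>i. (norm (Tn i (u i) - yn i))\<^sup>2 + \<alpha>n i * (W x - e))
      \<longlongrightarrow> (norm (T x - y))\<^sup>2 + \<alpha> * (W x - e)) F"
      by (intro tendsto_intros \<alpha> y T)
    have "ereal (W x - e) < ereal (W x)" using that by simp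
    with lsc have "\<forall>\<^sub>F i in F. W x - e < W (u i)"
      unfolding le_Liminf_iff by fastforce
    moreover have "\<forall>\<^sub>F i in F. \<alpha>n i > 0"
      using \<alpha>(2,1) by (rule order_tendstoD(1))
    ultimately show "\<forall>\<^sub>F i in F. (norm (Tn i (u i) - yn i))\<^sup>2 + \<alpha>n i * (W x - e) \<le> b i"
      using le
    proof eventually_elim
      case (elim i)
      then have "\<alpha>n i * (W x - e) \<le> \<alpha>n i * W (u i)" by (intro mult_left_mono) auto
      with elim(3) show ?case unfolding tikhonov_def by linarith
    qed
  qed
  show ?thesis
  proof (rule field_le_epsilon)
    fix d :: real
    assume "d > 0"
    then show "tikhonov T y \<alpha> W x \<le> B + d"
      using approx[of "d / \<alpha>"] \<alpha>(1) by (simp add: tikhonov_def right_diff_distrib)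
  qed
qed

theorem corollary3p11:
  fixes T :: "'a::real_normed_vector \<Rightarrow> 'b::real_inner"
    and Tn :: "nat \<Rightarrow> 'a \<Rightarrow> 'b"
    and y :: 'b and yn :: "nat \<Rightarrow> 'b"
    and \<alpha> :: real and \<alpha>n :: "nat \<Rightarrow> real"
    and D :: "'a set" and W :: "'a \<Rightarrow> real"
    and xbar :: 'a and xn :: "nat \<Rightarrow> 'a"
  assumes "bounded_linear T"
    and "\<And>n. n \<ge> 1 \<Longrightarrow> bounded_linear (Tn n)"
    and "\<alpha> > 0"
    and "\<exists>\<gamma>\<ge>0. \<forall>x\<in>D. W x \<ge> - \<gamma>"
    and "\<And>s x. \<lbrakk>W_bounded_seq D W s; x \<in> D; s \<longlonglongrightarrow> x\<rbrakk> \<Longrightarrow>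
           \<exists>r :: nat \<Rightarrow> nat. strict_mono r \<and>
             ereal (W x) \<le> liminf (\<lambda>j. ereal (W (s (r j))))"
    and "\<And>s. W_bounded_seq D W s \<Longrightarrow>
           \<exists>(r :: nat \<Rightarrow> nat) x. strict_mono r \<and> x \<in> D \<and> (\<lambda>j. s (r j)) \<longlonglongrightarrow> x"
    and "\<alpha>n \<longlonglongrightarrow> \<alpha>"
    and "yn \<longlonglongrightarrow> y"
    and "uniform_on_W_bounded D W Tn T"
    and "global_minimizer_on D (tikhonov T y \<alpha> W) xbar"
    and "\<And>z. global_minimizer_on D (tikhonov T y \<alpha> W) z \<Longrightarrow> z = xbar"
    and "\<And>n. n \<ge> 1 \<Longrightarrow> global_minimizer_on D (tikhonov (Tn n) (yn n) (\<alpha>n n) W) (xn n)"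
  shows "xn \<longlonglongrightarrow> xbar"
proof -
  let ?J = "tikhonov T y \<alpha> W"
  let ?Jn = "\<lambda>n. tikhonov (Tn n) (yn n) (\<alpha>n n) W"
  note unif = assms(9)[unfolded uniform_on_W_bounded_def, rule_format]
  obtain \<gamma> where \<gamma>: "\<And>x. x \<in> D \<Longrightarrow> W x \<ge> - \<gamma>" using assms(4) by blast
  have xbar: "xbar \<in> D" using assms(10) by (simp add: is_arg_min_linorder)
  have xn: "xn n \<in> D" "\<And>z. z \<in> D \<Longrightarrow> ?Jn n (xn n) \<le> ?Jn n z" if "n \<ge> 1" for n
    using assms(12)[OF that] by (simp_all add: is_arg_min_linorder)
  have Jn_lim: "(\<lambda>n. ?Jn n z) \<longlonglongrightarrow> ?J z" if "z \<in> D" for z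
  proof (rule tikhonov_tendsto[OF assms(7,8)])
    \<comment> \<open>A single point is a \<open>W\<close>-bounded set; the summand 1 only makes its bound positive.\<close>
    show "(\<lambda>n. Tn n z) \<longlonglongrightarrow> T z"
      by (rule tendsto_uniform_limitI[OF unif[of "\<bar>W z\<bar> + 1"]]) (use that in auto)
  qed
  have xn_mem: "\<forall>\<^sub>F n in sequentially. xn n \<in> D"
    using eventually_ge_at_top[of 1] by eventually_elim (rule xn(1))
  have xn_le: "\<forall>\<^sub>F n in sequentially. ?Jn n (xn n) \<le> ?Jn n xbar"
    using eventually_ge_at_top[of 1] by eventually_elim (rule xn(2)[OF _ xbar])
  obtain c where c: "c > 0"
    and bnd: "\<forall>\<^sub>F n in sequentially. xn n \<in> {x \<in> D. \<bar>W x\<bar> \<le> c}"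
    by (rule tikhonov_minimizers_eventually_W_bounded[OF assms(3,7) \<gamma> xn_mem xn_le Jn_lim[OF xbar]])
  show ?thesis
  proof (rule LIMSEQ_if_subseq_has_subseq_LIMSEQ)
    show "\<forall>\<^sub>F n in sequentially. n \<ge> 1 \<and> xn n \<in> {x \<in> D. \<bar>W x\<bar> \<le> c}"
      using eventually_ge_at_top bnd by (rule eventually_conj)
  next
    fix r :: "nat \<Rightarrow> nat"
    assume r: "strict_mono r" and mem: "\<And>j. r j \<ge> 1 \<and> xn (r j) \<in> {x \<in> D. \<bar>W x\<bar> \<le> c}"
    have W_bdd: "W_bounded_seq D W (\<lambda>j. xn (r (q j)))" for q :: "nat \<Rightarrow> nat"
      using mem by (auto simp: W_bounded_seq_def W_bounded_def)
    obtain q :: "nat \<Rightarrow> nat" and x where q: "strict_mono q" and x: "x \<in> D"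
      and lim_q: "(\<lambda>j. xn (r (q j))) \<longlonglongrightarrow> x"
      using assms(6)[OF W_bdd[of "\<lambda>j. j"]] by blast
    obtain p :: "nat \<Rightarrow> nat" where p: "strict_mono p"
      and lsc: "ereal (W x) \<le> liminf (\<lambda>j. ereal (W (xn (r (q (p j))))))"
      using assms(5)[OF W_bdd x lim_q] by blast
    define m where "m j = r (q (p j))" for j
    have m: "filterlim m sequentially sequentially"
      unfolding m_def using r q p
      by (intro filterlim_subseq) (auto simp: strict_mono_def)
    have lim_m: "(\<lambda>j. xn (m j)) \<longlonglongrightarrow> x"
      unfolding m_def using LIMSEQ_subseq_LIMSEQ[OF lim_q p] by (simp add: o_def)
    have "uniform_limit {x \<in> D. \<bar>W x\<bar> \<le> c} (\<lambda>j. Tn (m j)) T sequentially"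
      using filterlim_compose[OF unif[OF c] m] .
    then have T_lim: "(\<lambda>j. Tn (m j) (xn (m j))) \<longlonglongrightarrow> T x"
    proof (rule tendsto_uniform_limit_moving_argument)
      show "(\<lambda>j. T (xn (m j))) \<longlonglongrightarrow> T x"
        using assms(1) lim_m by (rule bounded_linear.tendsto)
    qed (use mem in \<open>simp add: m_def\<close>)
    have "?J x \<le> ?J z" if z: "z \<in> D" for z
    proof (rule tikhonov_le_of_perturbed_le[where F = sequentially
          and Tn = "\<lambda>j. Tn (m j)" and u = "\<lambda>j. xn (m j)"])
      show "(\<lambda>j. \<alpha>n (m j)) \<longlonglongrightarrow> \<alpha>" "(\<lambda>j. yn (m j)) \<longlonglongrightarrow> y" "(\<lambda>j. ?Jn (m j) z) \<longlonglongrightarrow> ?J z"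
        using filterlim_compose[OF assms(7) m] filterlim_compose[OF assms(8) m]
          filterlim_compose[OF Jn_lim[OF z] m] .
      show "\<forall>\<^sub>F j in sequentially. ?Jn (m j) (xn (m j)) \<le> ?Jn (m j) z"
        using mem xn(2)[OF _ z] by (simp add: m_def)
    qed (use assms(3) T_lim lsc in \<open>simp_all add: m_def\<close>)
    with x have "x = xbar" by (intro assms(11)) (simp add: is_arg_min_linorder)
    with q lim_q show "\<exists>q :: nat \<Rightarrow> nat. strict_mono q \<and> (\<lambda>j. xn (r (q j))) \<longlonglongrightarrow> xbar" by blast
  qed
qed

end
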